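(* Let $(X,d)$ be a discrete metric space, and $f\colon\mathbb R_+\to\mathbb R_+$ be a function. Then the following are equivalent. (1) $\mathrm{ad}_X\preceq f$. (2) There exists a function $g\colon\mathbb R_+\to\mathbb R_+$ which has the same growth type as $f$, such that for all $l\in\mathbb N$, all $k=1,2,\dots,3l$ and all $x\in X$, one can assign a subset $S(x,k,l)\subseteq X$, satisfying: i) for every $l\in\mathbb N$ there exists $S_l>0$ such that $S(x,k,l)\subseteq B(x,S_l)$ for all $x\in X$ and all $k=1,\dots,3l$; ii) for every $l\in\mathbb N$, all $k,k'$ with $1\leqslant k\leqslant k'\leqslant 3l$ and all $x\in X$, $S(x,k,l)\subseteq S(x,k',l)$; iii) for every $l\in\mathbb N$ and all $x,y\in X$ with $d(x,y)\leqslant l$: $S(x,k-d(x,y),l)\subset S(x,k,l)\cap S(y,k,l)$ for $k=d(x,y)+1,\dots,3l$; and $S(x,k+d(x,y),l)\supset S(x,k,l)\cap S(y,k,l)$ for $k=1,\dots,3l-d(x,y)$; iv) for every $l\in\mathbb N$, all $k=1,2,\dots,3l$ and all $x\in X$, $\sharp S(x,k,l)\leqslant g(l)$.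
   Context: $B(x,r)$ is the closed ball of radius $r$ about $x$, $\sharp$ denotes cardinality, and $\subset,\supset$ denote not necessarily strict inclusion. For a cover $\mathcal U$ of $X$: $m(\mathcal U)$ is the maximal number of elements of $\mathcal U$ with non-empty intersection; $\mathcal U$ is uniformly bounded if $\sup_{U\in\mathcal U}\operatorname{diam}U<\infty$; $\lambda>0$ is a Lebesgue number of $\mathcal U$ if every subset $A\subseteq X$ with diameter $\leqslant\lambda$ is contained in some $U\in\mathcal U$; $L(\mathcal U)$ is the supremum of the Lebesgue numbers of $\mathcal U$. The asymptotic dimension function of $X$ is $\mathrm{ad}_X(\lambda)=\min\{m(\mathcal U):\mathcal U\text{ a uniformly bounded cover of }X,\ L(\mathcal U)>\lambda\}-1$. For functions $f,g$ on $\mathbb R_+$, $f\preceq g$ means there is $k\in\mathbb N$ such that $f(x)\leqslant k\,g(kx+k)+k$ for all $x>k$; $f$ and $g$ have the same growth type if $f\preceq g$ and $g\preceq f$.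
   Formalization: The formal version requires f to be nondecreasing and every S(x,k,l) to be non-empty, as the equivalence fails otherwise; in iii) the index shift d(x,y) is rounded up to an integer, which changes nothing for integer-valued metrics. *)

theory Defs
  imports "HOL-Analysis.Analysis"
begin

text \<open>
  A metric space is a set \<open>X\<close> in a type of class \<open>metric_space\<close>, with the restricted distance.
\<close>

definition covers :: "'a set \<Rightarrow> 'a set set \<Rightarrow> bool" where
  "covers X \<U> \<longleftrightarrow> \<Union>\<U> = X"

text \<open>
  The library function \<open>diameter\<close> is unspecified on unbounded sets, so every bound on a
  diameter is accompanied by \<open>bounded\<close>.
\<close>

definition uniformly_bounded :: "'a::metric_space set set \<Rightarrow> bool" where
  "uniformly_bounded \<U> \<longleftrightarrow> (\<exists>D. \<forall>U\<in>\<U>. bounded U \<and> diameter U \<le> D)"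

text \<open>
  The value is \<open>\<infinity>\<close> if there is no finite maximum. Finite subfamilies suffice,
  since an infinite family with a common point has finite subfamilies of every size.
\<close>

definition multiplicity_of :: "'a set set \<Rightarrow> enat" where
  "multiplicity_of \<U> = Sup {enat (card \<V>) | \<V>. \<V> \<subseteq> \<U> \<and> finite \<V> \<and> \<Inter>\<V> \<noteq> {}}"

definition is_Lebesgue_number :: "'a::metric_space set \<Rightarrow> 'a set set \<Rightarrow> real \<Rightarrow> bool" where
  "is_Lebesgue_number X \<U> r \<longleftrightarrow>
     r > 0 \<and> (\<forall>A\<subseteq>X. bounded A \<and> diameter A \<le> r \<longrightarrow> (\<exists>U\<in>\<U>. A \<subseteq> U))"

text \<open>The value is \<open>-\<infinity>\<close> if there is no Lebesgue number.\<close>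

definition Lebesgue_sup :: "'a::metric_space set \<Rightarrow> 'a set set \<Rightarrow> ereal" where
  "Lebesgue_sup X \<U> = Sup (ereal ` {r. is_Lebesgue_number X \<U> r})"

text \<open>
  The infimum in \<open>enat\<close> is a minimum, and is \<open>\<infinity>\<close> if no such cover has finite multiplicity.
  The subtraction takes place in \<open>ereal\<close>, so it is not truncated.
\<close>

definition asdim_fun :: "'a::metric_space set \<Rightarrow> real \<Rightarrow> ereal" where
  "asdim_fun X r =
     ereal_of_enat (Inf {multiplicity_of \<U> | \<U>.
       covers X \<U> \<and> uniformly_bounded \<U> \<and> Lebesgue_sup X \<U> > ereal r}) - 1"

text \<open>
  A function on \<open>\<real>\<^sub>+\<close> is a total function on \<open>real\<close> of which only the values on \<open>{0..}\<close> are used.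
  Values are extended reals because \<open>asdim_fun\<close> may be infinite.
\<close>

definition growth_le :: "(real \<Rightarrow> ereal) \<Rightarrow> (real \<Rightarrow> ereal) \<Rightarrow> bool" (infix "\<preceq>" 50) where
  "f \<preceq> g \<longleftrightarrow>
     (\<exists>k::nat. \<forall>x > real k. f x \<le> ereal (real k) * g (real k * x + real k) + ereal (real k))"

definition same_growth_type :: "(real \<Rightarrow> ereal) \<Rightarrow> (real \<Rightarrow> ereal) \<Rightarrow> bool" where
  "same_growth_type f g \<longleftrightarrow> f \<preceq> g \<and> g \<preceq> f"

text \<open>
  The distance occurs as an offset of an integer index. It is rounded up; for an integer-valued
  metric this is the distance itself.
\<close>

definition idist :: "'a::metric_space \<Rightarrow> 'a \<Rightarrow> nat" where
  "idist x y = nat \<lceil>dist x y\<rceil>"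

end

(* From a cover to sets: choose a point p U in every member U, and let S x k l consist of the points
   p U of those U that contain the ball of radius 3 l - k about x. A Lebesgue number of at least
   6 l makes S x k l nonempty, and the multiplicity of the cover bounds its cardinality.
   From sets to a cover: take the sets {x. z : S x (2 l) l} over all points z. A member of
   S x l l with x in A witnesses that A lies in one of them whenever A has diameter at most l,
   because S x l l is contained in S y (2 l) l for every y in A. *)

theory Submission
  imports Defs
begin

section \<open>Multiplicity and the asymptotic dimension function\<close>

lemma multiplicity_of_le:
  assumes "\<And>\<V> x. \<lbrakk>\<V> \<subseteq> \<U>; finite \<V>; \<V> \<noteq> {}; x \<in> \<Inter>\<V>\<rbrakk> \<Longrightarrow> card \<V> \<le> n"
  shows "multiplicity_of \<U> \<le> enat n"
  unfolding multiplicity_of_def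
proof (rule Sup_least)
  fix m assume "m \<in> {enat (card \<V>) | \<V>. \<V> \<subseteq> \<U> \<and> finite \<V> \<and> \<Inter>\<V> \<noteq> {}}"
  then obtain \<V> where \<V>: "m = enat (card \<V>)" "\<V> \<subseteq> \<U>" "finite \<V>" "\<Inter>\<V> \<noteq> {}"
    by blast
  then obtain x where "x \<in> \<Inter>\<V>" by blast
  \<comment> \<open>The empty family also occurs here, because its intersection is
    \<open>UNIV\<close>; it contributes cardinality 0.\<close>
  then show "m \<le> enat n"
    using \<V> assms[of \<V> x] by (cases "\<V> = {}") auto
qed

text \<open>Multiplicity tests only finite subfamilies, so finiteness has to be derived: infinitely
  many members through \<open>x\<close> would include \<open>Suc n\<close> of them, a finite
  subfamily exceeding the bound.\<close>

lemma card_members_le_multiplicity: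
  assumes "multiplicity_of \<U> \<le> enat n"
  shows "finite {U \<in> \<U>. x \<in> U}" and "card {U \<in> \<U>. x \<in> U} \<le> n"
proof -
  have bound: "card \<V> \<le> n" if "\<V> \<subseteq> {U \<in> \<U>. x \<in> U}" "finite \<V>" for \<V>
  proof -
    have "enat (card \<V>) \<le> multiplicity_of \<U>"
      unfolding multiplicity_of_def using that by (intro Sup_upper) blast
    with assms have "enat (card \<V>) \<le> enat n" by (rule order_trans[rotated])
    then show ?thesis by simp
  qed
  show fin: "finite {U \<in> \<U>. x \<in> U}"
  proof (rule ccontr)
    assume "infinite {U \<in> \<U>. x \<in> U}"
    then obtain \<V> where "finite \<V>" "card \<V> = Suc n" "\<V> \<subseteq> {U \<in> \<U>. x \<in> U}"
      using infinite_arbitrarily_large by blast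
    with bound[of \<V>] show False by simp
  qed
  show "card {U \<in> \<U>. x \<in> U} \<le> n" using bound fin by blast
qed

lemma asdim_fun_leI:
  assumes "covers X \<U>" "uniformly_bounded \<U>" "Lebesgue_sup X \<U> > ereal r"
    and "multiplicity_of \<U> \<le> enat n"
  shows "asdim_fun X r \<le> ereal (real n - 1)"
proof -
  have "Inf {multiplicity_of \<U> | \<U>.
      covers X \<U> \<and> uniformly_bounded \<U> \<and> Lebesgue_sup X \<U> > ereal r} \<le> enat n"
    using assms by (intro Inf_lower2[of "multiplicity_of \<U>"]) blast+
  then have "asdim_fun X r \<le> ereal_of_enat (enat n) - 1"
    unfolding asdim_fun_def by (intro ereal_minus_mono) (simp_all only: ereal_of_enat_le_iff order_refl)
  then show ?thesis by (simp add: one_ereal_def)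
qed

text \<open>A real bound forces the infimum in \<open>enat\<close> to be finite, hence to be
  attained by well-ordering. This yields an actual cover; \<open>c + 1\<close> undoes the
  subtraction of 1.\<close>

lemma asdim_fun_leE:
  assumes "asdim_fun X r \<le> ereal c"
  obtains \<U> n where "covers X \<U>" "uniformly_bounded \<U>" "Lebesgue_sup X \<U> > ereal r"
    "multiplicity_of \<U> = enat n" "real n \<le> c + 1"
proof -
  define M where "M = {multiplicity_of \<U> | \<U>.
      covers X \<U> \<and> uniformly_bounded \<U> \<and> Lebesgue_sup X \<U> > ereal r}"
  have le: "ereal_of_enat (Inf M) - 1 \<le> ereal c"
    using assms unfolding asdim_fun_def M_def .
  have "Inf M \<noteq> \<infinity>"
  proof
    assume "Inf M = \<infinity>"
    with le show False by (simp add: one_ereal_def)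
  qed
  then obtain n where n: "Inf M = enat n" by (cases "Inf M") auto
  have "M \<noteq> {}" using n by (auto simp: top_enat_def)
  then have "Inf M \<in> M"
    by (auto simp: Inf_enat_def intro: LeastI)
  have "real n \<le> c + 1" using le by (simp add: n one_ereal_def)
  from \<open>Inf M \<in> M\<close> obtain \<U> where "covers X \<U>" "uniformly_bounded \<U>"
    "Lebesgue_sup X \<U> > ereal r" "multiplicity_of \<U> = enat n"
    unfolding n unfolding M_def by auto
  then show thesis using \<open>real n \<le> c + 1\<close> by (rule that)
qed

section \<open>Passing between covers and assigned sets\<close>

lemma diameter_le_if_subset_cball:
  assumes "A \<subseteq> cball z s" "0 \<le> s"
  shows "diameter A \<le> 2 * s"
proof (cases "A = {}")
  case False
  have "dist x y \<le> 2 * s" if "x \<in> A" "y \<in> A" for x y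
  proof -
    have "x \<in> cball z s" "y \<in> cball z s" using that assms(1) by blast+
    then show ?thesis using dist_triangle3[of x y z] by simp
  qed
  with False show ?thesis unfolding diameter_def by (auto intro!: cSUP_least)
qed (use assms(2) in simp)

text \<open>Only two levels of the assigned sets matter for this direction: \<open>A\<close>
  supplies witnesses, while \<open>B\<close> defines the cover and carries the bounds. The gap
  \<open>r < l\<close> gives the strict inequality for the supremum, as \<open>l\<close> itself
  becomes a Lebesgue number.\<close>

lemma asdim_fun_le_if_bounded_choice:
  fixes A B :: "'a::metric_space \<Rightarrow> 'a set"
  assumes "0 < l" "r < l"
    and nonempty: "\<And>x. x \<in> X \<Longrightarrow> A x \<noteq> {}"
    and sub: "\<And>x y. \<lbrakk>x \<in> X; y \<in> X; dist x y \<le> l\<rbrakk> \<Longrightarrow> A x \<subseteq> B y"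
    and near: "\<And>x. x \<in> X \<Longrightarrow> B x \<subseteq> cball x R"
    and fin: "\<And>x. x \<in> X \<Longrightarrow> finite (B x)"
    and card: "\<And>x. x \<in> X \<Longrightarrow> card (B x) \<le> n"
  shows "asdim_fun X r \<le> ereal (real n - 1)"
proof -
  define C where "C z = {x \<in> X. z \<in> B x}" for z
  have "covers X (range C)"
    \<comment> \<open>Covering is \<open>sub\<close> at \<open>y = x\<close>: a point of the
      nonempty \<open>A x\<close> lies in \<open>B x\<close>.\<close>
    using sub nonempty \<open>0 < l\<close> unfolding covers_def C_def by (fastforce dest: sub)
  moreover have "uniformly_bounded (range C)"
  proof -
    have "bounded (C z) \<and> diameter (C z) \<le> 2 * \<bar>R\<bar>" for z
    proof -
      \<comment> \<open>The absolute value supplies a nonnegative radius, since the sign of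
        \<open>R\<close> is unknown when \<open>X\<close> is empty.\<close>
      have "C z \<subseteq> cball z \<bar>R\<bar>"
        using near unfolding C_def by (force simp: dist_commute)
      then show ?thesis
        using bounded_subset bounded_cball diameter_le_if_subset_cball[of "C z" z "\<bar>R\<bar>"] by auto
    qed
    then show ?thesis unfolding uniformly_bounded_def by blast
  qed
  moreover have "Lebesgue_sup X (range C) > ereal r"
  proof -
    have "\<exists>U\<in>range C. E \<subseteq> U" if E: "E \<subseteq> X" "bounded E" "diameter E \<le> l" for E
    proof (cases "E = {}")
      case False
      then obtain x where x: "x \<in> E" by blast
      then obtain z where z: "z \<in> A x" using nonempty E by blast
      have "y \<in> C z" if "y \<in> E" for y
      proof -
        have "dist x y \<le> l"
          using diameter_bounded_bound[OF E(2) x that] E(3) by linarith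
        then show ?thesis using sub[of x y] x that z E(1) unfolding C_def by blast
      qed
      then show ?thesis by blast
    qed simp
    then have "is_Lebesgue_number X (range C) l"
      unfolding is_Lebesgue_number_def using \<open>0 < l\<close> by blast
    then have "ereal l \<le> Lebesgue_sup X (range C)"
      unfolding Lebesgue_sup_def by (intro Sup_upper) blast
    moreover have "ereal r < ereal l" using \<open>r < l\<close> by simp
    ultimately show ?thesis by (rule order_less_le_trans[rotated])
  qed
  moreover have "multiplicity_of (range C) \<le> enat n"
  proof (rule multiplicity_of_le)
    fix \<V> x assume \<V>: "\<V> \<subseteq> range C" "\<V> \<noteq> {}" "x \<in> \<Inter>\<V>"
    then have "x \<in> X" unfolding C_def by blast
    \<comment> \<open>The members through \<open>x\<close> are exactly the \<open>C z\<close> with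
      \<open>z\<close> in \<open>B x\<close>, so they are indexed by \<open>B x\<close>.\<close>
    have "\<V> \<subseteq> C ` B x" using \<V> unfolding C_def by blast
    then have "card \<V> \<le> card (B x)" using fin[OF \<open>x \<in> X\<close>] by (rule surj_card_le[rotated])
    also have "\<dots> \<le> n" using card \<open>x \<in> X\<close> .
    finally show "card \<V> \<le> n" .
  qed
  ultimately show ?thesis by (rule asdim_fun_leI)
qed

text \<open>Indexing by a real radius \<open>s\<close> turns the shift conditions into the triangle
  inequality for balls. Balls of radius at most \<open>L\<close> have diameter at most
  \<open>2 * L\<close>, below a Lebesgue number; \<open>0 \<le> s\<close> puts \<open>x\<close> into
  its own ball, so multiplicity at \<open>x\<close> applies.\<close>

lemma ball_indexed_sets_if_asdim_fun_le:
  fixes X :: "'a::metric_space set"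
  assumes "asdim_fun X r \<le> ereal c" "2 * L \<le> r"
  obtains T :: "'a \<Rightarrow> real \<Rightarrow> 'a set" and R :: real
  where "R > 0"
    and "\<And>x s. \<lbrakk>x \<in> X; 0 \<le> s; s \<le> L\<rbrakk> \<Longrightarrow> T x s \<noteq> {}"
    and "\<And>x s. \<lbrakk>x \<in> X; 0 \<le> s\<rbrakk> \<Longrightarrow> T x s \<subseteq> X \<inter> cball x R"
    and "\<And>x y s t. t + dist x y \<le> s \<Longrightarrow> T x s \<subseteq> T y t"
    and "\<And>x s. \<lbrakk>x \<in> X; 0 \<le> s\<rbrakk> \<Longrightarrow> finite (T x s) \<and> real (card (T x s)) \<le> c + 1"
proof -
  from assms(1) obtain \<U> n where \<U>: "covers X \<U>" "uniformly_bounded \<U>"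
    "Lebesgue_sup X \<U> > ereal r" "multiplicity_of \<U> = enat n" "real n \<le> c + 1"
    by (rule asdim_fun_leE)
  from \<U>(3) obtain r' where r': "is_Lebesgue_number X \<U> r'" "r < r'"
    unfolding Lebesgue_sup_def less_Sup_iff by auto
  obtain D where D: "\<And>U. U \<in> \<U> \<Longrightarrow> bounded U \<and> diameter U \<le> D"
    using \<U>(2) unfolding uniformly_bounded_def by blast
  \<comment> \<open>The chosen point depends on \<open>U\<close> alone, so inclusions between
    families of members pass to their images under \<open>p\<close>. Coincidences among chosen
    points only lower the cardinality.\<close>
  define p :: "'a set \<Rightarrow> 'a" where "p U = (SOME z. z \<in> U)" for U
  have p: "p U \<in> U" if "x \<in> U" for x U
    unfolding p_def using that by (rule someI)
  \<comment> \<open>The ball is cut down to \<open>X\<close> because the Lebesgue property concerns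
    subsets of \<open>X\<close> only.\<close>
  define T where "T x s = p ` {U \<in> \<U>. X \<inter> cball x s \<subseteq> U}" for x s
  have members: "{U \<in> \<U>. X \<inter> cball x s \<subseteq> U} \<subseteq> {U \<in> \<U>. x \<in> U}" if "x \<in> X" "0 \<le> s" for x s
    using that by auto
  show thesis
  proof
    show "\<bar>D\<bar> + 1 > 0" by simp
    show "T x s \<noteq> {}" if "x \<in> X" "0 \<le> s" "s \<le> L" for x s
    proof -
      have "diameter (X \<inter> cball x s) \<le> 2 * s"
        using that by (intro diameter_le_if_subset_cball[of _ x]) auto
      also have "\<dots> \<le> r'" using that assms(2) r'(2) by simp
      finally have "diameter (X \<inter> cball x s) \<le> r'" .
      moreover have "bounded (X \<inter> cball x s)" by (simp add: bounded_Int)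
      ultimately obtain U where "U \<in> \<U>" "X \<inter> cball x s \<subseteq> U"
        using r'(1) unfolding is_Lebesgue_number_def by (meson Int_lower1)
      then show ?thesis unfolding T_def by blast
    qed
    show "T x s \<subseteq> X \<inter> cball x (\<bar>D\<bar> + 1)" if "x \<in> X" "0 \<le> s" for x s
    proof
      fix z assume "z \<in> T x s"
      then obtain U where U: "z = p U" "U \<in> \<U>" "x \<in> U"
        using members[OF \<open>x \<in> X\<close> \<open>0 \<le> s\<close>] unfolding T_def by blast
      then have "z \<in> U" using p by blast
      then have "dist x z \<le> D"
        using diameter_bounded_bound[of U x z] D[OF U(2)] U(3) by linarith
      moreover have "z \<in> X" using \<open>z \<in> U\<close> U(2) \<U>(1) unfolding covers_def by blast
      ultimately show "z \<in> X \<inter> cball x (\<bar>D\<bar> + 1)" by simp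
    qed
    show "T x s \<subseteq> T y t" if "t + dist x y \<le> s" for x y s t
    proof -
      \<comment> \<open>The smaller ball lies in every member that contains the larger one.\<close>
      have "cball y t \<subseteq> cball x s"
      proof
        show "z \<in> cball x s" if "z \<in> cball y t" for z
          using that \<open>t + dist x y \<le> s\<close> dist_triangle[of x z y] by simp
      qed
      then show ?thesis unfolding T_def by blast
    qed
    show "finite (T x s) \<and> real (card (T x s)) \<le> c + 1" if "x \<in> X" "0 \<le> s" for x s
    proof
      note mult = card_members_le_multiplicity[OF eq_refl[OF \<U>(4)], of x]
      have fin: "finite {U \<in> \<U>. X \<inter> cball x s \<subseteq> U}"
        using mult(1) members[OF that] by (rule rev_finite_subset)
      then show "finite (T x s)" unfolding T_def by simp
      have "card (T x s) \<le> card {U \<in> \<U>. X \<inter> cball x s \<subseteq> U}"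
        unfolding T_def using fin by (rule card_image_le)
      also have "\<dots> \<le> card {U \<in> \<U>. x \<in> U}" using mult(1) members[OF that] by (rule card_mono)
      also have "\<dots> \<le> n" by (rule mult(2))
      finally show "real (card (T x s)) \<le> c + 1" using \<U>(5) by linarith
    qed
  qed
qed

section \<open>Rounded distances and the equivalence\<close>

lemma dist_le_idist: "dist x y \<le> real (idist x y)"
  unfolding idist_def by linarith

lemma idist_le: "dist x y \<le> real l \<Longrightarrow> idist x y \<le> l"
  unfolding idist_def by (simp add: ceiling_le_iff)

text \<open>Nonemptiness excludes the choice of empty sets, which would meet all other conditions
  with \<open>g = f\<close>. Monotonicity of \<open>f\<close> allows values at the various rescaled
  arguments to be compared.\<close>

theorem theorem3p1:
  fixes X :: "'a::metric_space set" and f :: "real \<Rightarrow> real"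
  assumes "discrete X"
    and "\<And>t. t \<ge> 0 \<Longrightarrow> f t \<ge> 0"
    and "mono_on {0..} f"
  shows "asdim_fun X \<preceq> (\<lambda>t. ereal (f t)) \<longleftrightarrow>
    (\<exists>g :: real \<Rightarrow> real.
      (\<forall>t\<ge>0. g t \<ge> 0) \<and>
      same_growth_type (\<lambda>t. ereal (g t)) (\<lambda>t. ereal (f t)) \<and>
      (\<exists>S :: 'a \<Rightarrow> nat \<Rightarrow> nat \<Rightarrow> 'a set.
        (\<forall>l. \<forall>k\<in>{1..3*l}. \<forall>x\<in>X. S x k l \<noteq> {} \<and> S x k l \<subseteq> X) \<and>
        (\<forall>l. \<exists>S\<^sub>l>0. \<forall>x\<in>X. \<forall>k\<in>{1..3*l}. S x k l \<subseteq> cball x S\<^sub>l) \<and>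
        (\<forall>l k k'. \<forall>x\<in>X. 1 \<le> k \<and> k \<le> k' \<and> k' \<le> 3*l \<longrightarrow> S x k l \<subseteq> S x k' l) \<and>
        (\<forall>l. \<forall>x\<in>X. \<forall>y\<in>X. dist x y \<le> real l \<longrightarrow>
          (\<forall>k\<in>{idist x y + 1..3*l}. S x (k - idist x y) l \<subseteq> S x k l \<inter> S y k l) \<and>
          (\<forall>k\<in>{1..3*l - idist x y}. S x k l \<inter> S y k l \<subseteq> S x (k + idist x y) l)) \<and>
        (\<forall>l. \<forall>k\<in>{1..3*l}. \<forall>x\<in>X. finite (S x k l) \<and> real (card (S x k l)) \<le> g (real l))))"
  (is "_ \<preceq> ?f \<longleftrightarrow> ?R")
proof
  assume "asdim_fun X \<preceq> ?f"
  then obtain k0 where k0: "\<And>x. x > real k0 \<Longrightarrow>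
      asdim_fun X x \<le> ereal (real k0 * f (real k0 * x + real k0) + real k0)"
    unfolding growth_le_def by auto
  \<comment> \<open>The added 1 makes \<open>K\<close> exceed \<open>k0\<close>, so
    \<open>r t > k0\<close> already at \<open>t = 0\<close>, and gives
    \<open>K \<ge> 1\<close>.\<close>
  define K where "K = real k0 + 1"
  \<comment> \<open>The slope 6 is twice the largest radius factor 3.\<close>
  define r where "r t = 6 * t + K" for t
  \<comment> \<open>Without its final 1 this dominates the bound on
    \<open>asdim_fun X (r t)\<close>; the final 1 accounts for multiplicity being one more than
    dimension.\<close>
  define g where "g t = K * f (K * r t + K) + K + 1" for t
  have K: "K \<ge> 1" unfolding K_def by simp
  have f_le: "f s \<le> f t" if "0 \<le> s" "s \<le> t" for s t
    using assms(3) that by (auto intro: mono_onD)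
  have arg: "0 \<le> K * r t + K" "t \<le> K * r t + K" if "0 \<le> t" for t
  proof -
    have "0 \<le> r t" "t \<le> r t" using that K by (auto simp: r_def)
    then have "1 * r t \<le> K * r t" using K by (intro mult_right_mono) auto
    then show "0 \<le> K * r t + K" "t \<le> K * r t + K" using \<open>0 \<le> r t\<close> \<open>t \<le> r t\<close> K by linarith+
  qed
  have asdim: "asdim_fun X (r (real l)) \<le> ereal (g (real l) - 1)" for l
  proof -
    have r: "r (real l) > real k0" "r (real l) \<ge> 0" unfolding r_def K_def by simp_all
    have "f (real k0 * r (real l) + real k0) \<le> f (K * r (real l) + K)"
      using r by (intro f_le add_mono mult_right_mono) (auto simp: K_def)
    then have "real k0 * f (real k0 * r (real l) + real k0) \<le> K * f (K * r (real l) + K)"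
      using r assms(2) by (intro mult_mono) (auto simp: K_def)
    then show ?thesis
      using k0[OF r(1)] unfolding g_def by (elim order_trans) (simp add: K_def)
  qed
  \<comment> \<open>Bundling the properties lets \<open>T\<close> and \<open>R\<close> be chosen
    simultaneously for all \<open>l\<close>.\<close>
  define good where "good l T R \<longleftrightarrow> R > 0 \<and>
      (\<forall>x\<in>X. \<forall>s. 0 \<le> s \<and> s \<le> 3 * real l \<longrightarrow> T x s \<noteq> {}) \<and>
      (\<forall>x\<in>X. \<forall>s\<ge>0. T x s \<subseteq> X \<inter> cball x R) \<and>
      (\<forall>x y s t. t + dist x y \<le> s \<longrightarrow> T x s \<subseteq> T y t) \<and>
      (\<forall>x\<in>X. \<forall>s\<ge>0. finite (T x s) \<and> real (card (T x s)) \<le> g (real l))" for l T R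
  have "\<exists>T R. good l T R" for l
  proof -
    have bound: "2 * (3 * real l) \<le> r (real l)" using K by (simp add: r_def)
    obtain T and R :: real where "R > 0"
      "\<And>x s. \<lbrakk>x \<in> X; 0 \<le> s; s \<le> 3 * real l\<rbrakk> \<Longrightarrow> T x s \<noteq> {}"
      "\<And>x s. \<lbrakk>x \<in> X; 0 \<le> s\<rbrakk> \<Longrightarrow> T x s \<subseteq> X \<inter> cball x R"
      "\<And>x y s t. t + dist x y \<le> s \<Longrightarrow> T x s \<subseteq> T y t"
      "\<And>x s. \<lbrakk>x \<in> X; 0 \<le> s\<rbrakk> \<Longrightarrow> finite (T x s) \<and> real (card (T x s)) \<le> g (real l) - 1 + 1"
      by (rule ball_indexed_sets_if_asdim_fun_le[OF asdim bound]) (rule that)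
    then show ?thesis unfolding good_def by (intro exI[of _ T] exI[of _ R]) auto
  qed
  then obtain T R where good: "\<And>l. good l (T l) (R l)" by metis
  have R: "R l > 0"
    and nonempty: "\<lbrakk>x \<in> X; 0 \<le> s; s \<le> 3 * real l\<rbrakk> \<Longrightarrow> T l x s \<noteq> {}"
    and near: "\<lbrakk>x \<in> X; 0 \<le> s\<rbrakk> \<Longrightarrow> T l x s \<subseteq> X \<inter> cball x (R l)"
    and sub: "t + dist x y \<le> s \<Longrightarrow> T l x s \<subseteq> T l y t"
    and card: "\<lbrakk>x \<in> X; 0 \<le> s\<rbrakk> \<Longrightarrow> finite (T l x s) \<and> real (card (T l x s)) \<le> g (real l)"
    for l x y s t
    using good[of l] unfolding good_def by blast+
  define S where "S x k l = T l x (3 * real l - real k)" for x k l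
  \<comment> \<open>This single inclusion gives both (ii), at \<open>y = x\<close>, and (iii).
    Rounding distances up is the safe direction: the integer shift shrinks the radius by at least
    \<open>dist x y\<close>.\<close>
  have S_mono: "S x k l \<subseteq> S y k' l" if "k + idist x y \<le> k'" for x y k k' l
    unfolding S_def
  proof (rule sub)
    have "real (k + idist x y) \<le> real k'" using that by (simp only: of_nat_le_iff)
    then show "3 * real l - real k' + dist x y \<le> 3 * real l - real k"
      using dist_le_idist[of x y] by simp
  qed
  have radius: "0 \<le> 3 * real l - real k" "3 * real l - real k \<le> 3 * real l" if "k \<in> {1..3*l}" for k l
    using that by auto
  have idist_refl: "idist x x = 0" for x :: 'a unfolding idist_def by simp
  show ?R
  proof (intro exI[of _ g] conjI exI[of _ S])
    show "\<forall>t\<ge>0. g t \<ge> 0"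
      using K arg assms(2) unfolding g_def by (auto intro!: add_nonneg_nonneg mult_nonneg_nonneg)
    show "same_growth_type (\<lambda>t. ereal (g t)) ?f"
      unfolding same_growth_type_def
    proof
      \<comment> \<open>A natural number with \<open>M \<ge> 6 * K\<close>,
        \<open>M \<ge> K\<^sup>2 + K\<close> and \<open>M \<ge> K + 1\<close>: the slope and
        constant of \<open>K * r x + K\<close>, and the additive constant of
        \<open>g\<close>.\<close>
      define M where "M = 6 * (k0 + 1) + (k0 + 1)\<^sup>2 + 2 * (k0 + 1)"
      have M: "real M = 6 * K + K\<^sup>2 + 2 * K" unfolding M_def K_def by simp
      show "(\<lambda>t. ereal (g t)) \<preceq> ?f"
        unfolding growth_le_def
      proof (intro exI[of _ M] allI impI)
        fix x assume "x > real M"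
        then have x: "x > 0" using of_nat_0_le_iff[of M] by linarith
        have "K * r x + K = 6 * K * x + (K\<^sup>2 + K)" by (simp add: r_def algebra_simps power2_eq_square)
        also have "\<dots> \<le> real M * x + real M"
          using x K by (intro add_mono mult_right_mono) (auto simp: M)
        finally have "f (K * r x + K) \<le> f (real M * x + real M)" using x arg(1)[of x] by (intro f_le) auto
        moreover have "K \<le> real M" "K + 1 \<le> real M" unfolding M using K zero_le_power2[of K] by linarith+
        moreover have "0 \<le> f (K * r x + K)" using x by (intro assms(2) arg(1)) simp
        ultimately have "K * f (K * r x + K) \<le> real M * f (real M * x + real M)"
          by (intro mult_mono) simp_all
        with \<open>K + 1 \<le> real M\<close> have "g x \<le> real M * f (real M * x + real M) + real M"
          unfolding g_def by linarith
        then show "ereal (g x) \<le> ereal (real M) * ereal (f (real M * x + real M)) + ereal (real M)"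
          by simp
      qed
      show "?f \<preceq> (\<lambda>t. ereal (g t))"
        unfolding growth_le_def
      \<comment> \<open>The factor 1 suffices, since \<open>K \<ge> 1\<close> and the argument of
        \<open>f\<close> inside \<open>g (x + 1)\<close> is at least \<open>x + 1\<close>.\<close>
      proof (intro exI[of _ 1] allI impI)
        fix x assume x: "x > real 1"
        then have "f x \<le> f (K * r (x + 1) + K)" using arg(2)[of "x + 1"] by (intro f_le) auto
        also have "\<dots> \<le> K * f (K * r (x + 1) + K)"
          using K x assms(2)[OF arg(1)[of "x + 1"]] by (simp add: mult_le_cancel_right1)
        also have "\<dots> \<le> g (x + 1)" using K unfolding g_def by simp
        finally show "ereal (f x) \<le> ereal (real 1) * ereal (g (real 1 * x + real 1)) + ereal (real 1)"
          by simp
      qed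
    qed
    show "\<forall>l. \<forall>k\<in>{1..3*l}. \<forall>x\<in>X. S x k l \<noteq> {} \<and> S x k l \<subseteq> X"
      unfolding S_def using nonempty[OF _ radius] near[OF _ radius(1)] by blast
    show "\<forall>l. \<exists>S\<^sub>l>0. \<forall>x\<in>X. \<forall>k\<in>{1..3*l}. S x k l \<subseteq> cball x S\<^sub>l"
    proof
      show "\<exists>S\<^sub>l>0. \<forall>x\<in>X. \<forall>k\<in>{1..3*l}. S x k l \<subseteq> cball x S\<^sub>l" for l
        unfolding S_def using R near[OF _ radius(1)] by (intro exI[of _ "R l"]) blast
    qed
    show "\<forall>l k k'. \<forall>x\<in>X. 1 \<le> k \<and> k \<le> k' \<and> k' \<le> 3*l \<longrightarrow> S x k l \<subseteq> S x k' l"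
      using S_mono by (simp add: idist_refl)
    show "\<forall>l. \<forall>x\<in>X. \<forall>y\<in>X. dist x y \<le> real l \<longrightarrow>
        (\<forall>k\<in>{idist x y + 1..3*l}. S x (k - idist x y) l \<subseteq> S x k l \<inter> S y k l) \<and>
        (\<forall>k\<in>{1..3*l - idist x y}. S x k l \<inter> S y k l \<subseteq> S x (k + idist x y) l)"
      \<comment> \<open>In the first inclusion \<open>k > idist x y\<close> makes the natural
        subtraction exact. The second follows from the factor \<open>S x k l\<close> by monotonicity
        in the index.\<close>
      by (intro allI ballI impI conjI Int_greatest le_infI1 S_mono) (auto simp: idist_refl)
    show "\<forall>l. \<forall>k\<in>{1..3*l}. \<forall>x\<in>X. finite (S x k l) \<and> real (card (S x k l)) \<le> g (real l)"
      unfolding S_def using card radius(1) by blast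
  qed
next
  assume ?R
  then obtain g :: "real \<Rightarrow> real" and S :: "'a \<Rightarrow> nat \<Rightarrow> nat \<Rightarrow> 'a set"
    where g_nonneg: "\<forall>t\<ge>0. g t \<ge> 0"
      and g: "same_growth_type (\<lambda>t. ereal (g t)) ?f"
      and nonempty: "\<forall>l. \<forall>k\<in>{1..3*l}. \<forall>x\<in>X. S x k l \<noteq> {} \<and> S x k l \<subseteq> X"
      and near: "\<forall>l. \<exists>R>0. \<forall>x\<in>X. \<forall>k\<in>{1..3*l}. S x k l \<subseteq> cball x R"
      and mono: "\<forall>l k k'. \<forall>x\<in>X. 1 \<le> k \<and> k \<le> k' \<and> k' \<le> 3*l \<longrightarrow> S x k l \<subseteq> S x k' l"
      and shift: "\<forall>l. \<forall>x\<in>X. \<forall>y\<in>X. dist x y \<le> real l \<longrightarrow>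
        (\<forall>k\<in>{idist x y + 1..3*l}. S x (k - idist x y) l \<subseteq> S x k l \<inter> S y k l) \<and>
        (\<forall>k\<in>{1..3*l - idist x y}. S x k l \<inter> S y k l \<subseteq> S x (k + idist x y) l)"
      and card: "\<forall>l. \<forall>k\<in>{1..3*l}. \<forall>x\<in>X. finite (S x k l) \<and> real (card (S x k l)) \<le> g (real l)"
    by (elim exE conjE) (rule that)
  have asdim: "asdim_fun X x \<le> ereal (g (real l))" if "l > 0" "x < real l" for l x
  proof -
    obtain R where R: "\<forall>x\<in>X. \<forall>k\<in>{1..3*l}. S x k l \<subseteq> cball x R" using near by blast
    \<comment> \<open>The two levels are \<open>S x l l\<close> and \<open>S x (2 * l) l\<close>;
      \<open>l > 0\<close> puts both indices into \<open>{1..3*l}\<close>. The floor converts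
      \<open>g\<close> into a natural bound.\<close>
    have "asdim_fun X x \<le> ereal (real (nat \<lfloor>g (real l)\<rfloor>) - 1)"
    proof (rule asdim_fun_le_if_bounded_choice)
      show "0 < real l" "x < real l" using that by simp_all
      show "S x l l \<noteq> {}" if "x \<in> X" for x using nonempty that \<open>l > 0\<close> by simp
      show "S x (2 * l) l \<subseteq> cball x R" if "x \<in> X" for x using R that \<open>l > 0\<close> by simp
      show "finite (S x (2 * l) l)" if "x \<in> X" for x using card that \<open>l > 0\<close> by simp
      show "card (S x (2 * l) l) \<le> nat \<lfloor>g (real l)\<rfloor>" if "x \<in> X" for x
        using card that \<open>l > 0\<close> g_nonneg by (simp add: le_nat_iff le_floor_iff)
      show "S x l l \<subseteq> S y (2 * l) l" if "x \<in> X" "y \<in> X" "dist x y \<le> real l" for x y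
      proof -
        have "idist x y \<le> l" using that(3) by (rule idist_le)
        \<comment> \<open>As \<open>l \<le> 2 * l - idist x y\<close>, (ii) raises the index at
          \<open>x\<close>; then (iii) with \<open>k = 2 * l\<close> moves to
          \<open>y\<close>.\<close>
        then have "S x l l \<subseteq> S x (2 * l - idist x y) l"
          using that \<open>l > 0\<close> by (intro mono[rule_format]) auto
        also have "\<dots> \<subseteq> S y (2 * l) l"
          using shift[rule_format, OF that] \<open>l > 0\<close> \<open>idist x y \<le> l\<close> by simp
        finally show ?thesis .
      qed
    qed
    also have "\<dots> \<le> ereal (g (real l))" using g_nonneg of_int_floor_le[of "g (real l)"] by (simp add: algebra_simps add_increasing)
    finally show ?thesis .
  qed
  obtain k where k: "\<And>x. x > real k \<Longrightarrow> g x \<le> real k * f (real k * x + real k) + real k"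
    using g unfolding same_growth_type_def growth_le_def by auto
  show "asdim_fun X \<preceq> ?f"
    unfolding growth_le_def
  \<comment> \<open>Rounding \<open>x\<close> up costs at most 1, and
    \<open>k * (x + 1) + k = k * x + 2 * k\<close>, whence the doubled constant.\<close>
  proof (intro exI[of _ "2 * k"] allI impI)
    fix x assume x: "x > real (2 * k)"
    \<comment> \<open>The least integer strictly above \<open>x\<close>; it also exceeds
      \<open>k\<close>, so the growth bound for \<open>g\<close> applies at
      \<open>l\<close>.\<close>
    define l where "l = nat \<lfloor>x\<rfloor> + 1"
    have "0 \<le> real (2 * k)" by simp
    then have l: "l > 0" "x < real l" "real l \<le> x + 1" unfolding l_def using x by linarith+
    have "real k * real l + real k \<le> real k * (x + 1) + real k"
      using l by (intro add_mono mult_left_mono) auto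
    also have "\<dots> \<le> real (2 * k) * x + real (2 * k)" using x by (simp add: algebra_simps)
    finally have "f (real k * real l + real k) \<le> f (real (2 * k) * x + real (2 * k))"
      using x by (intro mono_onD[OF assms(3)]) auto
    then have le: "real k * f (real k * real l + real k) + real k
        \<le> real (2 * k) * f (real (2 * k) * x + real (2 * k)) + real (2 * k)"
      using assms(2) x by (intro add_mono mult_mono) auto
    have "asdim_fun X x \<le> ereal (g (real l))" using l by (intro asdim)
    also have "\<dots> \<le> ereal (real k * f (real k * real l + real k) + real k)"
      using k[of "real l"] x l by simp
    also have "\<dots> \<le> ereal (real (2 * k) * f (real (2 * k) * x + real (2 * k)) + real (2 * k))"
      using le by (simp only: ereal_less_eq)
    finally show "asdim_fun X x \<le>
        ereal (real (2 * k)) * ereal (f (real (2 * k) * x + real (2 * k))) + ereal (real (2 * k))"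
      by (simp only: times_ereal.simps plus_ereal.simps)
  qed
qed

end
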